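(* For each edit type $\mathrm{edit} \in \{\mathrm{sub}, \mathrm{ins}, \mathrm{del}\}$, $\mathrm{AS}_{\mathrm{edit}}(\gamma, n) = O(\sqrt{n})$.
   Context: Strings are finite sequences over an alphabet $\Sigma$; $T[i]$ is the $i$-th character and $T[i..j]$ the substring from position $i$ to $j$. A set $\Gamma$ of positions of a nonempty string $T$ of length $n$ is a string attractor of $T$ if every substring $s$ of $T$ has an occurrence $T[i..j]=s$ with $i \le p \le j$ for some $p \in \Gamma$. $\gamma(T)$ denotes the minimum size of a string attractor of $T$. For a measure $c$ on strings, the worst-case additive sensitivity is $\mathrm{AS}_{\mathrm{edit}}(c,n) = \max\{ c(T') - c(T) \}$, where the maximum ranges over all strings $T$ of length $n$ and all strings $T'$ obtainable from $T$ by a single edit operation of type $\mathrm{edit}$: substitution of one character ($|T'|=n$), insertion of one character ($|T'|=n+1$), or deletion of one character ($|T'|=n-1$). *)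

theory Defs
  imports "HOL-Library.Sublist" "HOL-Library.Landau_Symbols"
begin

text \<open>Strings are lists; positions are 0-based, so the positions of \<open>T\<close> are \<open>{..<length T}\<close>.\<close>

definition substring :: "'a list \<Rightarrow> nat \<Rightarrow> nat \<Rightarrow> 'a list" where
  "substring T i j = map ((!) T) [i..<Suc j]"

text \<open>Only nonempty substrings have to be covered: an occurrence \<open>i \<le> p \<le> j\<close> is never empty.\<close>

definition string_attractor :: "'a list \<Rightarrow> nat set \<Rightarrow> bool" where
  "string_attractor T \<Gamma> \<longleftrightarrow>
     \<Gamma> \<subseteq> {..<length T} \<and>
     (\<forall>s. s \<noteq> [] \<and> sublist s T \<longrightarrow>
        (\<exists>i j. i \<le> j \<and> j < length T \<and> substring T i j = s \<and> (\<exists>p\<in>\<Gamma>. i \<le> p \<and> p \<le> j)))"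

text \<open>For the empty string, which a deletion can produce, this gives \<open>\<gamma> [] = 0\<close>.\<close>

definition attractor_size :: "'a list \<Rightarrow> nat" (\<open>\<gamma>\<close>) where
  "\<gamma> T = Min {card \<Gamma> | \<Gamma>. string_attractor T \<Gamma>}"

datatype edit_type = Sub | Ins | Del

text \<open>A substitution puts a different character at the chosen position.\<close>

fun edits_to :: "edit_type \<Rightarrow> 'a set \<Rightarrow> 'a list \<Rightarrow> 'a list \<Rightarrow> bool" where
  "edits_to Sub \<Sigma> T T' \<longleftrightarrow> (\<exists>u a b v. b \<in> \<Sigma> \<and> a \<noteq> b \<and> T = u @ [a] @ v \<and> T' = u @ [b] @ v)"
| "edits_to Ins \<Sigma> T T' \<longleftrightarrow> (\<exists>u b v. b \<in> \<Sigma> \<and> T = u @ v \<and> T' = u @ [b] @ v)"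
| "edits_to Del \<Sigma> T T' \<longleftrightarrow> (\<exists>u a v. T = u @ [a] @ v \<and> T' = u @ v)"

definition sensitivity_set ::
    "edit_type \<Rightarrow> 'a set \<Rightarrow> ('a list \<Rightarrow> nat) \<Rightarrow> nat \<Rightarrow> int set" where
  "sensitivity_set e \<Sigma> c n =
     {int (c T') - int (c T) | T T'. T \<in> lists \<Sigma> \<and> length T = n \<and> edits_to e \<Sigma> T T'}"

text \<open>The value \<open>0\<close> is a convention for the degenerate cases in which no edit is possible
  (for instance \<open>n = 0\<close> for substitutions and deletions, or substitutions over a one-letter
  alphabet).\<close>

definition AS :: "edit_type \<Rightarrow> 'a set \<Rightarrow> ('a list \<Rightarrow> nat) \<Rightarrow> nat \<Rightarrow> int" where
  "AS e \<Sigma> c n =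
     (if sensitivity_set e \<Sigma> c n = {} then 0 else Max (sensitivity_set e \<Sigma> c n))"

text \<open>The minimum and maximum above are attained: both sets are finite, also over an infinite
  alphabet, and every string has an attractor.\<close>

lemma substring_append: "substring (u @ s @ v) (length u) (length u + length s - 1) = s"
  if "s \<noteq> []"
proof -
  have "Suc (length u + length s - 1) = length u + length s"
    using that by (cases s) auto
  then show ?thesis
    unfolding substring_def by (intro nth_equalityI) (auto simp: nth_append)
qed

lemma string_attractor_all: "string_attractor T {..<length T}"
  unfolding string_attractor_def
proof (intro conjI allI impI)
  fix s assume "s \<noteq> [] \<and> sublist s T"
  then obtain u v where s: "s \<noteq> []" and T: "T = u @ s @ v"
    by (auto simp: sublist_def)
  let ?i = "length u" and ?j = "length u + length s - 1"
  have len: "length s > 0"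
    using s by simp
  then have "?i \<le> ?j" and "?j < length T"
    unfolding T length_append by linarith+
  then show "\<exists>i j. i \<le> j \<and> j < length T \<and> substring T i j = s \<and>
      (\<exists>p\<in>{..<length T}. i \<le> p \<and> p \<le> j)"
    using substring_append[OF s, of u v] T by (intro exI[of _ ?i] exI[of _ ?j]) auto
qed simp

lemma finite_attractor_sizes: "finite {card \<Gamma> | \<Gamma>. string_attractor T \<Gamma>}"
proof (rule finite_subset)
  show "{card \<Gamma> | \<Gamma>. string_attractor T \<Gamma>} \<subseteq> card ` Pow {..<length T}"
    by (auto simp: string_attractor_def)
qed simp

lemma attractor_size_attained: "\<exists>\<Gamma>. string_attractor T \<Gamma> \<and> card \<Gamma> = \<gamma> T"
proof -
  have "\<gamma> T \<in> {card \<Gamma> | \<Gamma>. string_attractor T \<Gamma>}"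
    unfolding attractor_size_def
    using string_attractor_all by (intro Min_in finite_attractor_sizes) auto
  then show ?thesis by auto
qed

lemma attractor_size_le: "string_attractor T \<Gamma> \<Longrightarrow> \<gamma> T \<le> card \<Gamma>"
  unfolding attractor_size_def by (intro Min_le finite_attractor_sizes) auto

lemma attractor_size_le_length: "\<gamma> T \<le> length T"
  using attractor_size_le[OF string_attractor_all, of T] by simp

lemma edits_to_length: "edits_to e \<Sigma> T T' \<Longrightarrow> length T' \<le> Suc (length T)"
  by (cases e) auto

lemma finite_sensitivity_set: "finite (sensitivity_set e \<Sigma> \<gamma> n)"
proof (rule finite_subset)
  show "sensitivity_set e \<Sigma> \<gamma> n \<subseteq> {- int n..int (Suc n)}"
  proof
    fix d assume "d \<in> sensitivity_set e \<Sigma> \<gamma> n"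
    then obtain T T' where d: "d = int (\<gamma> T') - int (\<gamma> T)" and T: "length T = n"
      and "edits_to e \<Sigma> T T'"
      by (auto simp: sensitivity_set_def)
    then have "length T' \<le> Suc n"
      using edits_to_length by blast
    then show "d \<in> {- int n..int (Suc n)}"
      using d T attractor_size_le_length[of T] attractor_size_le_length[of T'] by auto
  qed
qed simp

end

theory Submission
  imports Defs
begin

text \<open>Let \<open>\<Gamma>\<close> be an attractor of \<open>T\<close> and let \<open>T'\<close> differ from \<open>T\<close> at one place. Transport \<open>\<Gamma>\<close> to
  \<open>T'\<close>, and add the edited position and all multiples of some \<open>m\<close> close to \<open>sqrt n\<close>; the latter hit every
  substring of length at least \<open>m\<close>. A substring \<open>s\<close> of \<open>T'\<close> that is still not covered is shorter
  than \<open>m\<close> and has an occurrence in \<open>T\<close> that crosses the edited place, starting at some distance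
  \<open>a < m\<close> to the left of it. For each such \<open>a\<close> all these \<open>s\<close> are prefixes of the longest one, so a
  single extra position per \<open>a\<close>, inside an occurrence of the longest one in \<open>T'\<close>, covers them.\<close>

section \<open>Attractors expressed through occurrences\<close>

definition occurs_at :: "'a list \<Rightarrow> 'a list \<Rightarrow> nat \<Rightarrow> bool" where
  "occurs_at s T i \<longleftrightarrow> i + length s \<le> length T \<and> (\<forall>k<length s. T ! (i + k) = s ! k)"

definition covered :: "'a list \<Rightarrow> nat set \<Rightarrow> 'a list \<Rightarrow> bool" where
  "covered T \<Gamma> s \<longleftrightarrow> (\<exists>i. occurs_at s T i \<and> (\<exists>p\<in>\<Gamma>. i \<le> p \<and> p < i + length s))"

lemma coveredI: "occurs_at s T i \<Longrightarrow> p \<in> \<Gamma> \<Longrightarrow> i \<le> p \<Longrightarrow> p < i + length s \<Longrightarrow> covered T \<Gamma> s"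
  by (auto simp: covered_def)

lemma sublist_iff_occurs_at: "sublist s T \<longleftrightarrow> (\<exists>i. occurs_at s T i)"
proof
  assume "sublist s T"
  then obtain u v where "T = u @ s @ v"
    by (auto simp: sublist_def)
  then show "\<exists>i. occurs_at s T i"
    by (intro exI[of _ "length u"]) (auto simp: occurs_at_def nth_append)
next
  assume "\<exists>i. occurs_at s T i"
  then obtain i where "occurs_at s T i" ..
  then have "take (length s) (drop i T) = s"
    by (intro nth_equalityI) (auto simp: occurs_at_def)
  then show "sublist s T"
    by (metis sublist_drop sublist_order.order_trans sublist_take)
qed

lemma substring_eq_iff_occurs_at:
  "i \<le> j \<and> j < length T \<and> substring T i j = s \<longleftrightarrow>
     s \<noteq> [] \<and> occurs_at s T i \<and> Suc j = i + length s"
proof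
  assume *: "i \<le> j \<and> j < length T \<and> substring T i j = s"
  then have s: "s = map ((!) T) [i..<Suc j]"
    by (simp add: substring_def del: upt_Suc)
  have len: "length s = Suc j - i"
    unfolding s by (simp del: upt_Suc)
  have "T ! (i + k) = s ! k" if "k < length s" for k
    using that len unfolding s by (simp del: upt_Suc)
  then show "s \<noteq> [] \<and> occurs_at s T i \<and> Suc j = i + length s"
    using * len by (auto simp: occurs_at_def)
next
  assume *: "s \<noteq> [] \<and> occurs_at s T i \<and> Suc j = i + length s"
  then have "substring T i j = s"
    unfolding substring_def by (intro nth_equalityI) (simp_all add: occurs_at_def del: upt_Suc)
  moreover have "length s > 0"
    using * by simp
  ultimately show "i \<le> j \<and> j < length T \<and> substring T i j = s"
    using * unfolding occurs_at_def by linarith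
qed

text \<open>Windows given by a start and a length are easier to shift than the inclusive ranges of
  \<open>substring\<close>; from here on only \<open>covered\<close> is used.\<close>

lemma string_attractor_iff_covered:
  "string_attractor T \<Gamma> \<longleftrightarrow>
     \<Gamma> \<subseteq> {..<length T} \<and> (\<forall>s i. s \<noteq> [] \<longrightarrow> occurs_at s T i \<longrightarrow> covered T \<Gamma> s)"
proof -
  have "(\<exists>i j. i \<le> j \<and> j < length T \<and> substring T i j = s \<and> (\<exists>p\<in>\<Gamma>. i \<le> p \<and> p \<le> j))
      \<longleftrightarrow> covered T \<Gamma> s" (is "?L \<longleftrightarrow> _") if "s \<noteq> []" for s
  proof -
    have "?L \<longleftrightarrow> (\<exists>i j. (s \<noteq> [] \<and> occurs_at s T i \<and> Suc j = i + length s) \<and>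
        (\<exists>p\<in>\<Gamma>. i \<le> p \<and> p \<le> j))"
      unfolding substring_eq_iff_occurs_at[symmetric] by blast
    also have "\<dots> \<longleftrightarrow> covered T \<Gamma> s"
    proof
      assume "covered T \<Gamma> s"
      then obtain i p where "occurs_at s T i" "p \<in> \<Gamma>" "i \<le> p" "p < i + length s"
        by (auto simp: covered_def)
      then show "\<exists>i j. (s \<noteq> [] \<and> occurs_at s T i \<and> Suc j = i + length s) \<and>
          (\<exists>p\<in>\<Gamma>. i \<le> p \<and> p \<le> j)"
        using that by (intro exI[of _ i] exI[of _ "i + length s - 1"]) auto
    next
      assume "\<exists>i j. (s \<noteq> [] \<and> occurs_at s T i \<and> Suc j = i + length s) \<and>
          (\<exists>p\<in>\<Gamma>. i \<le> p \<and> p \<le> j)"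
      then show "covered T \<Gamma> s"
        by (metis coveredI less_Suc_eq_le)
    qed
    finally show ?thesis .
  qed
  then show ?thesis
    unfolding string_attractor_def sublist_iff_occurs_at by blast
qed

section \<open>Windows, and words shared by two strings\<close>

lemma multiple_in_window:
  fixes m :: nat
  assumes "0 < m" "m \<le> l"
  shows "\<exists>k. i \<le> k * m \<and> k * m < i + l"
proof (cases "m dvd i")
  case True
  then obtain k where "i = k * m"
    by (metis dvd_div_mult_self)
  then show ?thesis
    using assms by (intro exI[of _ k]) auto
next
  case False
  have "i div m * m + i mod m = i" "i mod m < m" "0 < i mod m"
    using assms False by (auto simp: mod_greater_zero_iff_not_dvd)
  then have "i \<le> Suc (i div m) * m" "Suc (i div m) * m < i + l"
    using assms(2) unfolding mult_Suc by linarith+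
  then show ?thesis by blast
qed

text \<open>As \<open>x\<close> has at most one letter, a window that neither ends within
  \<open>u\<close> nor starts in \<open>v\<close> must contain position \<open>length u\<close>.
  This holds for \<open>x = []\<close> too, where that position is the first one of
  \<open>v\<close>.\<close>

lemma occurs_at_append_cases:
  assumes "occurs_at s (u @ x @ v) i" "length x \<le> 1"
  obtains (left) "occurs_at s u i"
  | (right) k where "i = length u + length x + k" "occurs_at s v k"
  | (cross) "i \<le> length u" "length u < i + length s"
proof -
  consider "i + length s \<le> length u" | "length u + length x \<le> i"
    | "i \<le> length u" "length u < i + length s"
    using assms(2) by linarith
  then show thesis
  proof cases
    case 1
    have "u ! (i + k) = s ! k" if "k < length s" for k
      using that assms(1) 1 by (auto simp: occurs_at_def nth_append)
    then show thesis
      using 1 left by (auto simp: occurs_at_def)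
  next
    case 2
    then obtain k where k: "i = length u + length x + k"
      using le_Suc_ex by blast
    have "v ! (k + l) = s ! l" if "l < length s" for l
      using that assms(1) k by (auto simp: occurs_at_def nth_append)
    then show thesis
      using right[OF k] assms(1) k by (auto simp: occurs_at_def)
  qed (fact cross)
qed

lemma occurs_at_appendI1: "occurs_at s u i \<Longrightarrow> occurs_at s (u @ w) i"
  by (auto simp: occurs_at_def nth_append)

lemma occurs_at_appendI2: "occurs_at s v k \<Longrightarrow> occurs_at s (w @ v) (length w + k)"
  by (auto simp: occurs_at_def nth_append)

text \<open>Among the words that occur at \<open>i\<close> in \<open>T\<close> and somewhere in \<open>T'\<close>, the longest one
  has all the others as prefixes.\<close>
lemma common_occurrence:
  "\<exists>j. \<forall>s. occurs_at s T i \<longrightarrow> sublist s T' \<longrightarrow> occurs_at s T' j"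
proof -
  define P where "P l \<longleftrightarrow> (\<exists>s. length s = l \<and> occurs_at s T i \<and> sublist s T')" for l
  show ?thesis
  proof (cases "\<exists>l. P l")
    case True
    then have "P (GREATEST l. P l)"
      by (rule GreatestI_ex_nat[where b = "length T"]) (auto simp: P_def occurs_at_def)
    then obtain w j where w: "length w = (GREATEST l. P l)" "occurs_at w T i" "occurs_at w T' j"
      by (auto simp: P_def sublist_iff_occurs_at)
    have "occurs_at s T' j" if s: "occurs_at s T i" "sublist s T'" for s
    proof -
      have "P (length s)"
        using s by (auto simp: P_def)
      then have "length s \<le> length w"
        unfolding w(1)
        by (rule Greatest_le_nat[where b = "length T"]) (auto simp: P_def occurs_at_def)
      then show ?thesis
        using s(1) w(2,3) by (auto simp: occurs_at_def)
    qed
    then show ?thesis by blast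
  qed (auto simp: P_def)
qed

section \<open>Attractor sizes before and after one edit\<close>

lemma attractor_size_single_edit:
  assumes "length x \<le> 1" "length y \<le> 1" "0 < m"
  shows "\<gamma> (u @ y @ v) \<le> \<gamma> (u @ x @ v) + length (u @ y @ v) div m + m + 2"
proof -
  let ?T = "u @ x @ v" and ?T' = "u @ y @ v"
  obtain \<Gamma> where \<Gamma>: "string_attractor ?T \<Gamma>" "card \<Gamma> = \<gamma> ?T"
    using attractor_size_attained by blast
  then have fin: "finite \<Gamma>"
    by (auto simp: string_attractor_def intro: finite_subset)
  have "\<forall>a. \<exists>j. \<forall>s. occurs_at s ?T (length u - a) \<longrightarrow> sublist s ?T' \<longrightarrow> occurs_at s ?T' j"
    using common_occurrence by blast
  then obtain f where f: "\<And>a s. occurs_at s ?T (length u - a) \<Longrightarrow> sublist s ?T' \<Longrightarrow>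
      occurs_at s ?T' (f a)"
    by metis
  \<comment> \<open>\<open>g\<close> moves positions of \<open>v\<close> by the change in length. It
    is applied below only to positions of \<open>u\<close> and \<open>v\<close>, so its value at a
    replaced letter is irrelevant.\<close>
  define g where "g p = (if p < length u then p else p - length x + length y)" for p
  define grid where "grid = (\<lambda>k. k * m) ` {..length ?T' div m}"
  \<comment> \<open>If a word starts \<open>a\<close> letters before position
    \<open>length u\<close> in \<open>?T\<close>, its letter at offset \<open>a\<close> is the one
    at that position; \<open>f a + a\<close> is the place of this letter in the occurrence at
    \<open>f a\<close> in \<open>?T'\<close>.\<close>
  define marks where "marks = (\<lambda>a. f a + a) ` {..<m}"
  define \<Delta> where "\<Delta> = g ` \<Gamma> \<union> grid \<union> {length u} \<union> marks"
  have "covered ?T' \<Delta> s" if s: "s \<noteq> []" and occ: "occurs_at s ?T' i" for s i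
  proof (cases "m \<le> length s")
    case True
    then obtain k where k: "i \<le> k * m" "k * m < i + length s"
      using multiple_in_window[OF \<open>0 < m\<close>] by blast
    then have "k * m \<le> length ?T'"
      using occ by (auto simp: occurs_at_def)
    then have "k \<le> length ?T' div m"
      using \<open>0 < m\<close> by (simp add: less_eq_div_iff_mult_less_eq)
    then have "k * m \<in> \<Delta>"
      by (auto simp: \<Delta>_def grid_def)
    then show ?thesis
      using occ k by (blast intro: coveredI)
  next
    case False
    \<comment> \<open>The attractor of \<open>?T\<close> need not hit the occurrence at
      \<open>i'\<close>, only some occurrence at \<open>j\<close>, so the cases are those of
      \<open>j\<close>. That \<open>s\<close> also occurs in \<open>?T'\<close> is known from
      \<open>occ\<close>, and \<open>f\<close> relies on it.\<close>
    have from_T: "covered ?T' \<Delta> s" if "occurs_at s ?T i'" for i'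
    proof -
      have "covered ?T \<Gamma> s"
        using \<Gamma>(1) s that by (auto simp: string_attractor_iff_covered)
      then obtain j p where j: "occurs_at s ?T j" "p \<in> \<Gamma>" "j \<le> p" "p < j + length s"
        by (auto simp: covered_def)
      have g: "g p \<in> \<Delta>"
        using j by (auto simp: \<Delta>_def)
      from j(1) \<open>length x \<le> 1\<close> show ?thesis
      proof (cases rule: occurs_at_append_cases)
        case left
        then have "g p = p"
          using j by (auto simp: g_def occurs_at_def)
        then show ?thesis
          using g j left by (auto intro!: coveredI[of s _ j p] occurs_at_appendI1)
      next
        case (right k)
        have "occurs_at s ?T' (length u + length y + k)"
          using occurs_at_appendI2[OF right(2), of "u @ y"] by simp
        moreover have "length u + length y + k \<le> g p" "g p < length u + length y + k + length s"
          using j right by (auto simp: g_def)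
        ultimately show ?thesis
          using g by (blast intro: coveredI)
      next
        case cross
        let ?a = "length u - j"
        have "occurs_at s ?T' (f ?a)"
          using f[of s ?a] j(1) cross occ by (auto simp: sublist_iff_occurs_at)
        \<comment> \<open>Here \<open>?a < length s < m\<close>, so \<open>m\<close> marks
          suffice.\<close>
        moreover have "f ?a + ?a \<in> marks"
          using cross False unfolding marks_def by (intro imageI) auto
        then have "f ?a + ?a \<in> \<Delta>"
          by (auto simp: \<Delta>_def)
        moreover have "?a < length s"
          using cross by linarith
        ultimately show ?thesis
          by (auto intro!: coveredI[of s _ "f ?a" "f ?a + ?a"])
      qed
    qed
    from occ \<open>length y \<le> 1\<close> show ?thesis
    proof (cases rule: occurs_at_append_cases)
      case left
      then show ?thesis
        by (intro from_T occurs_at_appendI1)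
    next
      case (right k)
      then show ?thesis
        using from_T occurs_at_appendI2[of s v k "u @ x"] by simp
    next
      case cross
      then show ?thesis
        using occ by (auto intro!: coveredI[of s _ i "length u"] simp: \<Delta>_def)
    qed
  qed
  \<comment> \<open>\<open>\<Delta>\<close> may leave the string, for instance at a multiple of
    \<open>m\<close> equal to \<open>length ?T'\<close>. A position that covers a word lies inside
    an occurrence, so cutting off the rest loses nothing.\<close>
  moreover have "covered ?T' (\<Delta> \<inter> {..<length ?T'}) s" if "covered ?T' \<Delta> s" for s
    using that unfolding covered_def occurs_at_def
    by (meson IntI lessThan_iff order_less_le_trans)
  ultimately have "string_attractor ?T' (\<Delta> \<inter> {..<length ?T'})"
    unfolding string_attractor_iff_covered by blast
  then have "\<gamma> ?T' \<le> card (\<Delta> \<inter> {..<length ?T'})"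
    by (rule attractor_size_le)
  also have "\<dots> \<le> card \<Delta>"
    using fin by (intro card_mono) (auto simp: \<Delta>_def grid_def marks_def)
  also have "\<dots> \<le> card (g ` \<Gamma>) + card grid + card {length u} + card marks"
    unfolding \<Delta>_def by (meson add_le_mono1 card_Un_le order_trans)
  \<comment> \<open>The multiples of \<open>m\<close> start at 0, which gives the
    \<open>Suc\<close>; with the edited position this makes the constant 2.\<close>
  also have "\<dots> \<le> card \<Gamma> + Suc (length ?T' div m) + 1 + m"
    using card_image_le[OF fin, of g] card_image_le[of "{..length ?T' div m}" "\<lambda>k. k * m"]
      card_image_le[of "{..<m}" "\<lambda>a. f a + a"]
    by (simp add: grid_def marks_def)
  finally show ?thesis
    using \<Gamma>(2) by simp
qed

section \<open>The three edit types and the asymptotic bound\<close>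

lemma edits_to_decomp:
  assumes "edits_to e \<Sigma> T T'"
  obtains u x y v where "T = u @ x @ v" "T' = u @ y @ v" "length x \<le> 1" "length y \<le> 1"
proof (cases e)
  case Sub
  with assms obtain u a b v where "T = u @ [a] @ v" "T' = u @ [b] @ v"
    by auto
  then show thesis by (rule that) auto
next
  case Ins
  with assms obtain u b v where "T = u @ [] @ v" "T' = u @ [b] @ v"
    by auto
  then show thesis by (rule that) auto
next
  case Del
  with assms obtain u a v where "T = u @ [a] @ v" "T' = u @ [] @ v"
    by auto
  then show thesis by (rule that) auto
qed

lemma attractor_size_edit_diff:
  assumes "edits_to e \<Sigma> T T'" "length T = n"
  shows "\<bar>real (\<gamma> T') - real (\<gamma> T)\<bar> \<le> 2 * sqrt (real n) + 4"
proof -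
  \<comment> \<open>Rounding up past the root gives \<open>n < m * m\<close>, hence
    \<open>n + 1 \<le> m * m\<close>: the quotient stays at most \<open>m\<close> even after an
    insertion.\<close>
  define m where "m = Suc (nat \<lfloor>sqrt (real n)\<rfloor>)"
  have m: "0 < m" "real m \<le> sqrt (real n) + 1" "sqrt (real n) < real m"
    by (auto simp: m_def) linarith+
  have "real n = sqrt (real n) ^ 2"
    by simp
  also have "\<dots> < real m ^ 2"
    using m(3) by (intro power_strict_mono) auto
  finally have "real n < real (m * m)"
    by (simp add: power2_eq_square)
  then have "n < m * m"
    unfolding of_nat_less_iff .
  then have div: "l div m \<le> m" if "l \<le> Suc n" for l
    using that m(1) div_le_mono[of l "m * m" m] by simp
  obtain u x y v where uv: "T = u @ x @ v" "T' = u @ y @ v" "length x \<le> 1" "length y \<le> 1"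
    using assms(1) by (rule edits_to_decomp)
  \<comment> \<open>The single-edit bound is used in both directions, with \<open>x\<close> and
    \<open>y\<close> exchanged.\<close>
  have "\<gamma> T' \<le> \<gamma> T + length T' div m + m + 2" "\<gamma> T \<le> \<gamma> T' + length T div m + m + 2"
    unfolding uv(1,2) by (intro attractor_size_single_edit uv m)+
  moreover have "length T' div m \<le> m" "length T div m \<le> m"
    using edits_to_length[OF assms(1)] assms(2) by (auto intro: div)
  ultimately have "\<gamma> T' \<le> \<gamma> T + 2 * m + 2" "\<gamma> T \<le> \<gamma> T' + 2 * m + 2"
    by linarith+
  then show ?thesis
    using m(2) by linarith
qed

theorem theorem2:
  fixes \<Sigma> :: "'a set" and e :: edit_type
  shows "(\<lambda>n. real_of_int (AS e \<Sigma> \<gamma> n)) \<in> O(\<lambda>n. sqrt (real n))"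
proof (rule bigoI[of _ 6])
  show "\<forall>\<^sub>F n in sequentially.
      norm (real_of_int (AS e \<Sigma> \<gamma> n)) \<le> 6 * norm (sqrt (real n))"
    using eventually_ge_at_top[of 1]
  proof eventually_elim
    case (elim n)
    then have n: "1 \<le> sqrt (real n)"
      by simp
    \<comment> \<open>The norm requires a two-sided bound, since \<open>AS\<close> can be negative,
      as for a deletion with \<open>n = 1\<close>. For \<open>sqrt n \<ge> 1\<close> this bound is
      at most \<open>6 * sqrt n\<close>.\<close>
    have "\<bar>real_of_int (AS e \<Sigma> \<gamma> n)\<bar> \<le> 2 * sqrt (real n) + 4"
    proof (cases "sensitivity_set e \<Sigma> \<gamma> n = {}")
      case False
      then have "AS e \<Sigma> \<gamma> n \<in> sensitivity_set e \<Sigma> \<gamma> n"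
        by (simp add: AS_def Max_in[OF finite_sensitivity_set])
      then obtain T T' where "AS e \<Sigma> \<gamma> n = int (\<gamma> T') - int (\<gamma> T)" "length T = n"
        "edits_to e \<Sigma> T T'"
        by (auto simp: sensitivity_set_def)
      then show ?thesis
        using attractor_size_edit_diff by fastforce
    qed (simp add: AS_def)
    then show ?case
      using n unfolding real_norm_def by linarith
  qed
qed

end
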